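(* Let $\gamma\ge1$, let $p,s\in\mathcal P^\gamma$ satisfy $p(x)<s(x)$ for all $x\in[0;2\pi]$, and let $(\psi;\beta)\in\mathfrak B$. Then there exists a positive constant $C_{p,s}$ independent of $n$ such that for all $n\in\mathbb N$ $$\mathcal E\big(L^{\psi}_{\beta,p(\cdot)};\hat Z_n\big)_{s(\cdot)}\ge C_{p,s}\,\nu(n)\,n^{1/\overline p-1/\underline s},\qquad \nu(n)=\sup_{k\ge n}|\psi(k)|.$$
   Context: Variable exponent spaces. For a $2\pi$-periodic measurable essentially bounded function $p=p(x)$, $L^{p(\cdot)}$ is the space of measurable $2\pi$-periodic functions $f$ with $\int_{-\pi}^{\pi}|f(x)|^{p(x)}\,dx<\infty$, with norm $$\|f\|_{p(\cdot)}=\inf\Big\{\alpha>0:\ \int_{-\pi}^{\pi}\Big|\frac{f(x)}{\alpha}\Big|^{p(x)}dx\le 1\Big\}.$$ $\underline p=\operatorname{ess\,inf}_x|p(x)|$, $\overline p=\operatorname{ess\,sup}_x|p(x)|$, and similarly for $s$. $L$ is the space of $2\pi$-periodic functions integrable over a period. The function $p$ satisfies the Dini-Lipschitz condition of order $\gamma$ if there is a constant $K$ with $\omega(p;\delta)\big(\ln\frac1\delta\big)^{\gamma}\le K$ for all $0<\delta<1$, where $\omega(p;\delta)=\sup\{|p(x_1)-p(x_2)|:\ x_1,x_2\in[-\pi;\pi],\ |x_1-x_2|\le\delta\}$. For $\gamma\ge1$, $\mathcal P^\gamma$ is the set of $2\pi$-periodic exponents $p=p(x)>1$ satisfying the Dini-Lipschitz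 condition of order $\gamma$. $(\psi;\beta)$-derivatives. Let $\psi:\mathbb N\to\mathbb R$ be a function with $\psi(k)\neq0$ for all $k$, and let $\beta\in\mathbb R$. For $f\in L$ let $a_k(f),b_k(f)$ be its Fourier coefficients, and write its Fourier series as $S[f]=\frac{a_0(f)}2+\sum_{k=1}^\infty(a_k(f)\cos kx+b_k(f)\sin kx)\equiv\sum_{k=0}^\infty A_k(f;x)$. If the series $$\sum_{k=1}^\infty\frac1{\psi(k)}\Big(a_k(f)\cos\big(kx+\tfrac{\beta\pi}2\big)+b_k(f)\sin\big(kx+\tfrac{\beta\pi}2\big)\Big)$$ is the Fourier series of some function from $L$, this function is denoted $f^\psi_\beta$ and called the $(\psi;\beta)$-derivative of $f$; the set of all such $f$ is $L^\psi_\beta$. The class $L^\psi_{\beta,p(\cdot)}$ is the set of $f\in L^\psi_\beta$ such that $f^\psi_\beta\in L^{p(\cdot)}$ and $\|f^\psi_\beta\|_{p(\cdot)}\le1$. Analogue of Zigmund's sums. For $n\in\mathbb N$, $$\hat Z_n(f;x)=\frac{a_0(f)}2+\sum_{k=1}^{n-1}\Big(1-\frac{\psi(n)}{\psi(k)}\Big)A_k(f;x),$$ and $\mathcal E(L^\psi_{\beta,p(\cdot)};\hat Z_n)_{s(\cdot)}=\sup_{f\in L^\psi_{\beta,p(\cdot)}}\|f-\hat Z_n(f)\|_{s(\cdot)}$. The class $\mathfrak B$. Let $\nu(n)=\sup_{k\ge n}|\psi(k)|$. $\mathfrak B$ is the set of pairs $(\psi;\beta)$ for which there is a positive constant $C$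 independent of $n$ such that for every $n\in\mathbb N$ $$\sup_{n\le k\le 2n}\Big|\frac{\nu(n)}{\psi(k)}\Big|\le C,\qquad \sup_{m\in\mathbb N}\sum_{k=2^m}^{2^{m+1}}|\tau(k+1)-\tau(k)|\le C,$$ where (for the given $n$) $$\tau(k)=\begin{cases}0,&1\le k\le n-1,\\ \dfrac{\nu(n)}{\psi(k)},&n\le k\le 2n,\\ 0,&k>2n.\end{cases}$$ (The first condition includes that $\nu(n)<\infty$.) *)

theory Defs
  imports "HOL-Probability.Essential_Supremum" "HOL-Library.Periodic_Fun"
begin

text \<open>
  Functions on the circle are \<open>2\<pi>\<close>-periodic functions on the real line;
  integrals, measurability and essential bounds refer to one period.
\<close>

abbreviation period_measure :: "real measure" where
  "period_measure \<equiv> lebesgue_on {-pi..pi}"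

abbreviation periodic_2pi :: "(real \<Rightarrow> real) \<Rightarrow> bool" where
  "periodic_2pi f \<equiv> periodic_fun_simple f (2 * pi)"

definition ess_upper :: "(real \<Rightarrow> real) \<Rightarrow> ereal" where
  "ess_upper p = esssup period_measure (\<lambda>x. ereal \<bar>p x\<bar>)"

definition ess_lower :: "(real \<Rightarrow> real) \<Rightarrow> ereal" where
  "ess_lower p = - esssup period_measure (\<lambda>x. - ereal \<bar>p x\<bar>)"

definition variable_exponent :: "(real \<Rightarrow> real) \<Rightarrow> bool" where
  "variable_exponent p \<longleftrightarrow>
     periodic_2pi p \<and> p \<in> borel_measurable period_measure \<and> ess_upper p < \<infinity>"

definition modular :: "(real \<Rightarrow> real) \<Rightarrow> (real \<Rightarrow> real) \<Rightarrow> ennreal" where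
  "modular p f = (\<integral>\<^sup>+ x. ennreal (\<bar>f x\<bar> powr p x) \<partial>period_measure)"

definition Lp_var :: "(real \<Rightarrow> real) \<Rightarrow> (real \<Rightarrow> real) set" where
  "Lp_var p = {f. periodic_2pi f \<and> f \<in> borel_measurable period_measure \<and> modular p f < \<infinity>}"

text \<open>
  The norm takes values in \<open>[0, \<infinity>]\<close>: for a function admitting no \<open>\<alpha>\<close> the infimum
  over the empty set is \<open>\<infinity>\<close>.
\<close>

definition norm_var :: "(real \<Rightarrow> real) \<Rightarrow> (real \<Rightarrow> real) \<Rightarrow> ennreal" where
  "norm_var p f = (INF \<alpha>\<in>{\<alpha>::real. \<alpha> > 0 \<and> modular p (\<lambda>x. f x / \<alpha>) \<le> 1}. ennreal \<alpha>)"

text \<open>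
  The modulus of continuity is extended real valued, so that an unbounded \<open>p\<close> has
  modulus \<open>\<infinity>\<close> rather than an unspecified real supremum.
\<close>

definition modulus_cont :: "(real \<Rightarrow> real) \<Rightarrow> real \<Rightarrow> ereal" where
  "modulus_cont p \<delta> =
     Sup {ereal \<bar>p x1 - p x2\<bar> | x1 x2. x1 \<in> {-pi..pi} \<and> x2 \<in> {-pi..pi} \<and> \<bar>x1 - x2\<bar> \<le> \<delta>}"

definition dini_lipschitz :: "real \<Rightarrow> (real \<Rightarrow> real) \<Rightarrow> bool" where
  "dini_lipschitz \<gamma> p \<longleftrightarrow>
     (\<exists>K::real. \<forall>\<delta>. 0 < \<delta> \<and> \<delta> < 1 \<longrightarrow>
        modulus_cont p \<delta> * ereal (ln (1 / \<delta>) powr \<gamma>) \<le> ereal K)"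

definition exponent_class :: "real \<Rightarrow> (real \<Rightarrow> real) set" where
  "exponent_class \<gamma> =
     {p. variable_exponent p \<and> (\<forall>x. p x > 1) \<and> dini_lipschitz \<gamma> p}"

definition L_space :: "(real \<Rightarrow> real) set" where
  "L_space = {f. periodic_2pi f \<and> integrable period_measure f}"

definition fourier_a :: "(real \<Rightarrow> real) \<Rightarrow> nat \<Rightarrow> real" where
  "fourier_a f k = (LINT x|period_measure. f x * cos (real k * x)) / pi"

definition fourier_b :: "(real \<Rightarrow> real) \<Rightarrow> nat \<Rightarrow> real" where
  "fourier_b f k = (LINT x|period_measure. f x * sin (real k * x)) / pi"

definition fourier_term :: "(real \<Rightarrow> real) \<Rightarrow> nat \<Rightarrow> real \<Rightarrow> real" where
  "fourier_term f k x =
     (if k = 0 then fourier_a f 0 / 2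
      else fourier_a f k * cos (real k * x) + fourier_b f k * sin (real k * x))"

text \<open>
  The sequence \<open>\<psi>\<close> is indexed by the positive integers; the value \<open>\<psi> 0\<close> is never used.
  The derivative is determined only almost everywhere, hence a relation: \<open>g\<close> is a derivative
  of \<open>f\<close> if the Fourier series of \<open>g\<close> agrees term by term with the transformed series of \<open>f\<close>,
  which has no constant term.
\<close>

definition has_psi_derivative ::
  "(nat \<Rightarrow> real) \<Rightarrow> real \<Rightarrow> (real \<Rightarrow> real) \<Rightarrow> (real \<Rightarrow> real) \<Rightarrow> bool" where
  "has_psi_derivative \<psi> \<beta> f g \<longleftrightarrow>
     f \<in> L_space \<and> g \<in> L_space \<and> (\<forall>x. fourier_term g 0 x = 0) \<and>
     (\<forall>k\<ge>1. \<forall>x. fourier_term g k x =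
        1 / \<psi> k * (fourier_a f k * cos (real k * x + \<beta> * pi / 2)
                 + fourier_b f k * sin (real k * x + \<beta> * pi / 2)))"

definition psi_class :: "(nat \<Rightarrow> real) \<Rightarrow> real \<Rightarrow> (real \<Rightarrow> real) \<Rightarrow> (real \<Rightarrow> real) set" where
  "psi_class \<psi> \<beta> p =
     {f. \<exists>g. has_psi_derivative \<psi> \<beta> f g \<and> g \<in> Lp_var p \<and> norm_var p g \<le> 1}"

definition zygmund_sum :: "(nat \<Rightarrow> real) \<Rightarrow> nat \<Rightarrow> (real \<Rightarrow> real) \<Rightarrow> real \<Rightarrow> real" where
  "zygmund_sum \<psi> n f x =
     fourier_a f 0 / 2 + (\<Sum>k\<in>{1..<n}. (1 - \<psi> n / \<psi> k) * fourier_term f k x)"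

definition zygmund_error ::
  "(nat \<Rightarrow> real) \<Rightarrow> real \<Rightarrow> (real \<Rightarrow> real) \<Rightarrow> (real \<Rightarrow> real) \<Rightarrow> nat \<Rightarrow> ennreal" where
  "zygmund_error \<psi> \<beta> p s n =
     (SUP f\<in>psi_class \<psi> \<beta> p. norm_var s (\<lambda>x. f x - zygmund_sum \<psi> n f x))"

text \<open>
  \<open>nu \<psi> n\<close> is the intended supremum only if \<open>\<psi>\<close> is bounded, which the class \<open>pair_class\<close>
  requires explicitly.
\<close>

definition nu :: "(nat \<Rightarrow> real) \<Rightarrow> nat \<Rightarrow> real" where
  "nu \<psi> n = (SUP k\<in>{n..}. \<bar>\<psi> k\<bar>)"

definition tau :: "(nat \<Rightarrow> real) \<Rightarrow> nat \<Rightarrow> nat \<Rightarrow> real" where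
  "tau \<psi> n k = (if n \<le> k \<and> k \<le> 2 * n then nu \<psi> n / \<psi> k else 0)"

definition pair_class :: "((nat \<Rightarrow> real) \<times> real) set" where
  "pair_class =
     {(\<psi>, \<beta>). (\<forall>n\<ge>1. bdd_above ((\<lambda>k. \<bar>\<psi> k\<bar>) ` {n..})) \<and>
       (\<exists>C>0. \<forall>n\<ge>1.
          (\<forall>k\<in>{n..2 * n}. \<bar>nu \<psi> n / \<psi> k\<bar> \<le> C) \<and>
          (\<forall>m\<ge>1. (\<Sum>k\<in>{2 ^ m..2 ^ (m + 1)}. \<bar>tau \<psi> n (k + 1) - tau \<psi> n k\<bar>) \<le> C))}"

end

theory Submission
  imports Defs
begin

text \<open>
  For each \<open>n\<close> the test function is a multiple of \<open>f = \<nu>(n) \<Sum>\<^bsub>n\<le>k\<le>2n\<^esub> cos kx\<close>, which the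
  Zygmund sum of order \<open>n\<close> annihilates. It is at least \<open>n \<nu>(n) / 2\<close> on \<open>\<bar>x\<bar> \<le> 1/(2n)\<close>, so
  its \<open>s(\<cdot>)\<close>-norm is at least of order \<open>\<nu>(n) n\<^bsup>1 - 1/r\<^esup>\<close> with \<open>r = ess inf s\<close>. Its
  derivative \<open>\<Sum>\<^bsub>n\<le>k\<le>2n\<^esub> \<tau>(k) cos(kx + \<beta>\<pi>/2)\<close> has coefficients of bounded variation, so
  summation by parts against the Dirichlet kernel bounds it by a multiple of
  \<open>min(n, 1/\<bar>x\<bar>)\<close>; as \<open>q = ess sup p > 1\<close>, its \<open>p(\<cdot>)\<close>-norm is at most of order \<open>n\<^bsup>1 - 1/q\<^esup>\<close>.
\<close>

section \<open>Cosine sums with a phase, Abel summation and the variation of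
  \<open>tau\<close>\<close>

lemma half_le_sin:
  fixes u :: real
  assumes "0 \<le> u" "u \<le> pi / 2"
  shows "u / 2 \<le> sin u"
proof -
  \<comment> \<open>Monotonicity of \<open>F\<close> gives v cos v \<le> sin v. At v = u/2,
    multiplied by 2 cos(u/2), this becomes sin u \<ge> u cos^2(u/2) = (u/2)(1 + cos u), and cos u
    \<ge> 0.\<close>
  define F where "F = (\<lambda>v::real. sin v - v * cos v)"
  have "F 0 \<le> F (u / 2)"
  proof (rule DERIV_nonneg_imp_nondecreasing[of 0 "u / 2" F])
    fix v assume v: "0 \<le> v" "v \<le> u / 2"
    have "(F has_real_derivative v * sin v) (at v)"
      unfolding F_def by (auto intro!: derivative_eq_intros)
    moreover have "0 \<le> v * sin v"
      using v assms by (intro mult_nonneg_nonneg sin_ge_zero) auto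
    ultimately show "\<exists>y. (F has_real_derivative y) (at v) \<and> 0 \<le> y" by blast
  qed (use assms in auto)
  then have 1: "u / 2 * cos (u / 2) \<le> sin (u / 2)"
    by (simp add: F_def)
  have c: "0 \<le> cos (u / 2)"
    using assms by (intro cos_ge_zero) auto
  have "u / 2 \<le> u / 2 * (1 + cos u)"
    using assms cos_ge_zero[of u] by (simp add: algebra_simps)
  also have "\<dots> = 2 * (u / 2 * cos (u / 2)) * cos (u / 2)"
    using cos_double_cos[of "u / 2"] by (simp add: power2_eq_square)
  also have "\<dots> \<le> 2 * sin (u / 2) * cos (u / 2)"
    using mult_right_mono[OF 1 c] by simp
  also have "\<dots> = sin u"
    using sin_double[of "u / 2"] by simp
  finally show ?thesis .
qed

text \<open>Multiplication by 2 sin(x/2) turns each cosine into a difference of sines at the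
  half-integer frequencies k + 1/2 and k - 1/2, so consecutive terms cancel whatever the phase
  \<theta> is.\<close>

lemma sum_cos_telescope:
  fixes x \<theta> :: real
  assumes "m \<le> n"
  shows "2 * sin (x / 2) * (\<Sum>k=m..n. cos (real k * x + \<theta>)) =
    sin ((real n + 1 / 2) * x + \<theta>) - sin ((real m - 1 / 2) * x + \<theta>)"
proof -
  have tele: "2 * sin (x / 2) * cos (real k * x + \<theta>) =
      sin ((real k + 1 / 2) * x + \<theta>) - sin ((real k - 1 / 2) * x + \<theta>)" for k
  proof -
    have "sin ((real k * x + \<theta>) + x / 2) - sin ((real k * x + \<theta>) - x / 2)
        = 2 * sin (x / 2) * cos (real k * x + \<theta>)"
      by (simp add: sin_add sin_diff)
    moreover have "(real k * x + \<theta>) + x / 2 = (real k + 1 / 2) * x + \<theta>"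
      "(real k * x + \<theta>) - x / 2 = (real k - 1 / 2) * x + \<theta>"
      by (simp_all add: algebra_simps)
    ultimately show ?thesis by simp
  qed
  show ?thesis
    using assms
  proof (induction rule: dec_induct)
    case base
    then show ?case using tele[of m] by simp
  next
    case (step k)
    have "real (Suc k) - 1 / 2 = real k + 1 / 2" by simp
    with step tele[of "Suc k"]
    show ?case by (simp add: distrib_left del: of_nat_Suc)
  qed
qed

text \<open>After multiplication by 2 sin(x/2) only two sines remain, of total size at most 2, while
  \<open>half_le_sin\<close> at \<bar>x\<bar>/2 gives a factor of size at least \<bar>x\<bar>/2. The
  bound is uniform in \<open>m\<close>, \<open>n\<close> and \<theta>.\<close>

lemma abs_sum_cos_le:
  fixes x \<theta> :: real
  assumes "\<bar>x\<bar> \<le> pi" "x \<noteq> 0"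
  shows "\<bar>\<Sum>k=m..n. cos (real k * x + \<theta>)\<bar> \<le> 4 / \<bar>x\<bar>"
proof (cases "m \<le> n")
  case True
  define D where "D = (\<Sum>k=m..n. cos (real k * x + \<theta>))"
  have "\<bar>x\<bar> / 2 / 2 \<le> sin (\<bar>x\<bar> / 2)"
    using assms by (intro half_le_sin) auto
  also have "\<dots> \<le> \<bar>sin (x / 2)\<bar>"
    by (cases "x \<ge> 0") auto
  finally have "\<bar>x\<bar> / 2 \<le> \<bar>2 * sin (x / 2)\<bar>" by (simp add: abs_mult)
  then have "\<bar>x\<bar> / 2 * \<bar>D\<bar> \<le> \<bar>2 * sin (x / 2)\<bar> * \<bar>D\<bar>"
    by (rule mult_right_mono) simp
  also have "\<dots> = \<bar>2 * sin (x / 2) * D\<bar>"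
    by (simp add: abs_mult)
  also have "\<dots> \<le> 2"
    unfolding D_def sum_cos_telescope[OF True]
    using abs_sin_le_one[of "(real n + 1 / 2) * x + \<theta>"]
      abs_sin_le_one[of "(real m - 1 / 2) * x + \<theta>"] by linarith
  finally show ?thesis
    using assms by (simp add: D_def field_simps)
qed (use assms in auto)

lemma summation_by_parts:
  fixes t d :: "nat \<Rightarrow> real"
  assumes "m \<le> n"
  shows "(\<Sum>k=m..n. t k * d k) =
    t n * (\<Sum>j=m..n. d j) - (\<Sum>k=m..<n. (t (Suc k) - t k) * (\<Sum>j=m..k. d j))"
  using assms
proof (induction rule: dec_induct)
  case (step k)
  then show ?case by (simp add: algebra_simps)
qed simp

text \<open>Abel summation: for oscillating \<open>d\<close> the estimate depends on the partial
  sums of \<open>d\<close> and the variation of \<open>t\<close>, not on the number of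
  terms.\<close>

lemma abs_sum_le_variation:
  fixes t d :: "nat \<Rightarrow> real"
  assumes D: "\<And>k. \<bar>\<Sum>j=m..k. d j\<bar> \<le> M" and "m \<le> n"
  shows "\<bar>\<Sum>k=m..n. t k * d k\<bar> \<le> (\<bar>t n\<bar> + (\<Sum>k=m..<n. \<bar>t (Suc k) - t k\<bar>)) * M"
proof -
  have "\<bar>\<Sum>k=m..n. t k * d k\<bar> \<le> \<bar>t n * (\<Sum>j=m..n. d j)\<bar>
      + \<bar>\<Sum>k=m..<n. (t (Suc k) - t k) * (\<Sum>j=m..k. d j)\<bar>"
    unfolding summation_by_parts[OF \<open>m \<le> n\<close>] by linarith
  also have "\<dots> \<le> \<bar>t n\<bar> * M + (\<Sum>k=m..<n. \<bar>t (Suc k) - t k\<bar> * M)"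
    by (intro add_mono sum_abs[THEN order_trans] sum_mono)
      (auto simp: abs_mult intro!: mult_left_mono D)
  finally show ?thesis by (simp add: algebra_simps sum_distrib_left)
qed

text \<open>If 2^m \<le> n < 2^(m+1), then 2n < 2^(m+2), so the indices from n to 2n - 1 lie in two
  consecutive dyadic blocks, each contributing at most \<open>C\<close>.\<close>

lemma tau_variation_le:
  fixes C :: real
  assumes bound: "\<And>k. n \<le> k \<Longrightarrow> k \<le> 2 * n \<Longrightarrow> \<bar>nu \<psi> n / \<psi> k\<bar> \<le> C"
    and var: "\<And>m. m \<ge> 1 \<Longrightarrow>
      (\<Sum>k\<in>{2 ^ m..2 ^ (m + 1)}. \<bar>tau \<psi> n (k + 1) - tau \<psi> n k\<bar>) \<le> C"
    and n: "n \<ge> 1"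
  shows "(\<Sum>k=n..<2*n. \<bar>tau \<psi> n (Suc k) - tau \<psi> n k\<bar>) \<le> 2 * C"
proof (cases "n = 1")
  \<comment> \<open>Here the block would have m = 0, which \<open>var\<close> does not cover. Only
    the difference between indices 1 and 2 occurs, and \<open>bound\<close> controls both of its
    terms.\<close>
  case True
  have "\<bar>tau \<psi> n (Suc 1) - tau \<psi> n 1\<bar> \<le> \<bar>tau \<psi> n (Suc 1)\<bar> + \<bar>tau \<psi> n 1\<bar>"
    by linarith
  also have "\<dots> \<le> C + C"
    using bound[of 1] bound[of 2] True by (intro add_mono) (auto simp: tau_def numeral_2_eq_2)
  finally show ?thesis using True by (simp add: numeral_2_eq_2)
next
  case False
  obtain m where m: "2 ^ m \<le> n" "n < 2 ^ (m + 1)"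
    using ex_power_ivl1[of 2 n] n by auto
  have "m \<ge> 1" using m False n by (cases m) auto
  let ?f = "\<lambda>k. \<bar>tau \<psi> n (k + 1) - tau \<psi> n k\<bar>"
  have "(\<Sum>k=n..<2*n. ?f k) \<le> (\<Sum>k\<in>{2 ^ m..2 ^ (m + 1)} \<union> {2 ^ (m + 1)..2 ^ (m + 1 + 1)}. ?f k)"
    using m by (intro sum_mono2) auto
  \<comment> \<open>The blocks share the index 2^(m+1); counting it twice only increases the
    right-hand side.\<close>
  also have "\<dots> \<le> (\<Sum>k\<in>{2 ^ m..2 ^ (m + 1)}. ?f k) + (\<Sum>k\<in>{2 ^ (m + 1)..2 ^ (m + 1 + 1)}. ?f k)"
    by (subst sum.union_inter[symmetric]) (auto intro!: sum_nonneg)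
  also have "\<dots> \<le> C + C"
    using \<open>m \<ge> 1\<close> by (intro add_mono var) auto
  finally show ?thesis by simp
qed

section \<open>Fourier coefficients of finite cosine sums with a common phase\<close>

lemma integral_cos_period:
  "(LINT x|period_measure. cos (of_int m * x + \<theta>)) = (if m = 0 then 2 * pi * cos \<theta> else 0)"
proof (cases "m = 0")
  case False
  have "((\<lambda>x. cos (of_int m * x + \<theta>)) has_integral
      (sin (of_int m * pi + \<theta>) / of_int m - sin (of_int m * (- pi) + \<theta>) / of_int m)) {-pi..pi}"
    using False
    by (intro fundamental_theorem_of_calculus)
      (auto intro!: derivative_eq_intros
        simp: has_real_derivative_iff_has_vector_derivative[symmetric])
  moreover have "sin (of_int m * pi + \<theta>) = sin (of_int m * (- pi) + \<theta>)"
    using sin.plus_of_int[of "of_int m * (- pi) + \<theta>" m] by (simp add: algebra_simps)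
  ultimately have "integral {-pi..pi} (\<lambda>x. cos (of_int m * x + \<theta>)) = 0"
    by (simp add: integral_unique)
  then show ?thesis
    using False
    by (subst lebesgue_integral_eq_integral)
      (auto intro!: continuous_imp_integrable_real continuous_intros)
qed (simp add: measure_restrict_space)

lemma integral_cos_times_cos:
  assumes "k \<ge> 1"
  shows "(LINT x|period_measure. cos (real k * x + \<theta>) * cos (real j * x)) =
    (if j = k then pi * cos \<theta> else 0)"
proof -
  \<comment> \<open>The frequencies are integers because k - j may be negative. As k \<ge> 1, the
    frequency k + j never vanishes, so only the case j = k survives integration.\<close>
  have eq: "cos (real k * x + \<theta>) * cos (real j * x) =
      (cos (of_int (int k - int j) * x + \<theta>) + cos (of_int (int k + int j) * x + \<theta>)) / 2" for x
  proof -
    have "of_int (int k - int j) * x + \<theta> = (real k * x + \<theta>) - real j * x"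
      "of_int (int k + int j) * x + \<theta> = (real k * x + \<theta>) + real j * x"
      by (simp_all add: algebra_simps)
    then show ?thesis by (simp only: cos_add cos_diff) simp
  qed
  show ?thesis
    unfolding eq using assms
    by (subst integral_divide_zero, subst Bochner_Integration.integral_add)
      (auto simp: integral_cos_period simp del: of_int_add of_int_diff
         intro!: continuous_imp_integrable_real continuous_intros)
qed

lemma integral_cos_times_sin:
  assumes "k \<ge> 1"
  shows "(LINT x|period_measure. cos (real k * x + \<theta>) * sin (real j * x)) =
    (if j = k then - (pi * sin \<theta>) else 0)"
proof -
  \<comment> \<open>The phase shift by pi/2 expresses the product through cosines alone, so
    \<open>integral_cos_period\<close> applies again; for j = k the surviving term has cos(\<theta>
    - pi/2) = sin \<theta>, with a minus sign.\<close>
  have eq: "cos (real k * x + \<theta>) * sin (real j * x) =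
      (cos (of_int (int k + int j) * x + (\<theta> - pi / 2))
       - cos (of_int (int k - int j) * x + (\<theta> - pi / 2))) / 2" for x
  proof -
    have "of_int (int k - int j) * x + (\<theta> - pi / 2) = ((real k * x + \<theta>) - real j * x) - pi / 2"
      "of_int (int k + int j) * x + (\<theta> - pi / 2) = ((real k * x + \<theta>) + real j * x) - pi / 2"
      by (simp_all add: algebra_simps)
    then show ?thesis by (simp only: cos_diff[of _ "pi / 2"]) (simp add: sin_add sin_diff)
  qed
  show ?thesis
    unfolding eq using assms
    by (subst integral_divide_zero, subst Bochner_Integration.integral_diff)
      (auto simp: integral_cos_period cos_diff simp del: of_int_add of_int_diff
         intro!: continuous_imp_integrable_real continuous_intros)
qed

text \<open>Orthogonality picks out the term k = j. Frequency 0 is excluded because its coefficient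
  under this normalisation would be doubled.\<close>

lemma fourier_coeffs_cos_sum:
  fixes c :: "nat \<Rightarrow> real"
  assumes "finite A" "0 \<notin> A"
  shows "fourier_a (\<lambda>x. \<Sum>k\<in>A. c k * cos (real k * x + \<theta>)) j = (if j \<in> A then c j * cos \<theta> else 0)"
    and "fourier_b (\<lambda>x. \<Sum>k\<in>A. c k * cos (real k * x + \<theta>)) j = (if j \<in> A then - (c j * sin \<theta>) else 0)"
proof -
  have A: "k \<ge> 1" if "k \<in> A" for k
    using that assms(2) by (cases k) auto
  have "(LINT x|period_measure. (\<Sum>k\<in>A. c k * cos (real k * x + \<theta>)) * cos (real j * x)) =
      (\<Sum>k\<in>A. c k * (LINT x|period_measure. cos (real k * x + \<theta>) * cos (real j * x)))"
    unfolding sum_distrib_right mult.assoc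
    by (subst Bochner_Integration.integral_sum)
      (auto intro!: continuous_imp_integrable_real continuous_intros)
  also have "\<dots> = (\<Sum>k\<in>A. if j = k then c k * (pi * cos \<theta>) else 0)"
    using A by (intro sum.cong) (auto simp: integral_cos_times_cos)
  finally show "fourier_a (\<lambda>x. \<Sum>k\<in>A. c k * cos (real k * x + \<theta>)) j = (if j \<in> A then c j * cos \<theta> else 0)"
    using assms by (simp add: fourier_a_def)
  have "(LINT x|period_measure. (\<Sum>k\<in>A. c k * cos (real k * x + \<theta>)) * sin (real j * x)) =
      (\<Sum>k\<in>A. c k * (LINT x|period_measure. cos (real k * x + \<theta>) * sin (real j * x)))"
    unfolding sum_distrib_right mult.assoc
    by (subst Bochner_Integration.integral_sum)
      (auto intro!: continuous_imp_integrable_real continuous_intros)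
  also have "\<dots> = (\<Sum>k\<in>A. if j = k then - (c k * (pi * sin \<theta>)) else 0)"
    using A by (intro sum.cong) (auto simp: integral_cos_times_sin)
  finally show "fourier_b (\<lambda>x. \<Sum>k\<in>A. c k * cos (real k * x + \<theta>)) j = (if j \<in> A then - (c j * sin \<theta>) else 0)"
    using assms by (simp add: fourier_b_def)
qed

lemma cos_sum_in_L_space:
  fixes c :: "nat \<Rightarrow> real"
  shows "(\<lambda>x. \<Sum>k\<in>A. c k * cos (real k * x + \<theta>)) \<in> L_space"
proof -
  have "cos (real k * (x + 2 * pi) + \<theta>) = cos (real k * x + \<theta>)" for k x
    using cos.plus_of_nat[of "real k * x + \<theta>" k] by (simp add: algebra_simps)
  then have "periodic_2pi (\<lambda>x. \<Sum>k\<in>A. c k * cos (real k * x + \<theta>))"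
    by unfold_locales simp
  then show ?thesis
    by (auto simp: L_space_def intro!: continuous_imp_integrable_real continuous_intros)
qed

section \<open>The peak majorant and bounds in variable exponent spaces\<close>

text \<open>For N > 0 this is min(N, 1/\<bar>x\<bar>) with value N at the origin; the case
  distinction avoids the default 1/0 = 0, which would make the minimum vanish there.\<close>

definition peak_bound :: "real \<Rightarrow> real \<Rightarrow> real" where
  "peak_bound N x = (if \<bar>x\<bar> \<le> 1 / N then N else 1 / \<bar>x\<bar>)"

lemma peak_bound_nonneg: "N \<ge> 0 \<Longrightarrow> 0 \<le> peak_bound N x"
  by (simp add: peak_bound_def)

lemma peak_bound_measurable [measurable]: "peak_bound N \<in> borel_measurable borel"
  unfolding peak_bound_def by measurable

lemma nn_integral_powr_tail:
  fixes a q :: real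
  assumes "a > 0" "q > 1"
  shows "(\<integral>\<^sup>+x. ennreal (x powr (- q)) * indicator {a..} x \<partial>lborel) =
    ennreal (a powr (1 - q) / (q - 1))"
proof -
  have "((\<lambda>x::real. x powr (1 - q)) \<longlongrightarrow> 0) at_top"
    using assms by (intro tendsto_neg_powr filterlim_ident) auto
  then have lim: "((\<lambda>x::real. - (x powr (1 - q)) / (q - 1)) \<longlongrightarrow> 0) at_top"
    using tendsto_divide[OF tendsto_minus tendsto_const, of _ 0 at_top "q - 1"] assms by simp
  have "(\<integral>\<^sup>+x. ennreal (x powr (- q)) * indicator {a..} x \<partial>lborel) =
      ennreal (0 - - (a powr (1 - q)) / (q - 1))"
  proof (rule nn_integral_FTC_atLeast[OF _ _ _ lim])
    fix x assume "a \<le> x"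
    with assms have "x > 0" by simp
    then have "((\<lambda>x. - (x powr (1 - q)) / (q - 1)) has_real_derivative
        - ((1 - q) * x powr (1 - q - 1)) / (q - 1)) (at x)"
      by (intro DERIV_cdivide DERIV_minus has_real_derivative_powr)
    moreover have "- ((1 - q) * x powr (1 - q - 1)) / (q - 1) = x powr - q"
      using assms by (simp add: divide_simps) (simp add: algebra_simps)
    ultimately show "((\<lambda>x. - (x powr (1 - q)) / (q - 1)) has_real_derivative x powr - q) (at x)"
      by simp
  qed auto
  then show ?thesis by simp
qed

text \<open>The centre has length 2/N and contributes 2 N^(q-1); each of the two tails contributes
  N^(q-1)/(q-1). The constant is 2 + 2/(q-1) = 2q/(q-1).\<close>

lemma nn_integral_peak_bound:
  assumes "N > 0" "q > 1"
  shows "(\<integral>\<^sup>+x. ennreal (peak_bound N x powr q) \<partial>lborel) \<le>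
    ennreal (2 * q / (q - 1) * N powr (q - 1))"
proof -
  let ?t = "\<lambda>x. ennreal (x powr (- q)) * indicator {1 / N..} x"
  have pw: "ennreal (peak_bound N x powr q) \<le>
      ennreal (N powr q) * indicator {- (1 / N)..1 / N} x + (?t x + ?t (- x))" for x
  proof (cases "\<bar>x\<bar> \<le> 1 / N")
    case True
    then have "x \<in> {- (1 / N)..1 / N}" by auto
    then show ?thesis using True by (simp add: peak_bound_def)
  next
    case False
    have "0 < 1 / N" using assms by simp
    with False have "\<bar>x\<bar> > 0" by linarith
    then have "peak_bound N x powr q = \<bar>x\<bar> powr (- q)"
      using False by (simp add: peak_bound_def powr_divide powr_minus_divide)
    then show ?thesis
      using False by (cases "x \<ge> 0") auto
  qed
  have t: "integral\<^sup>N lborel ?t = ennreal (N powr (q - 1) / (q - 1))"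
    using nn_integral_powr_tail[of "1 / N" q] assms
    by (simp add: powr_divide powr_diff)
  have t': "(\<integral>\<^sup>+x. ?t (- x) \<partial>lborel) = ennreal (N powr (q - 1) / (q - 1))"
    using nn_integral_real_affine[of ?t "-1" 0] t by simp
  have "(\<integral>\<^sup>+x. ennreal (peak_bound N x powr q) \<partial>lborel) \<le>
      (\<integral>\<^sup>+x. ennreal (N powr q) * indicator {- (1 / N)..1 / N} x + (?t x + ?t (- x)) \<partial>lborel)"
    by (intro nn_integral_mono pw)
  also have "\<dots> = ennreal (N powr q) * ennreal (2 / N)
      + (ennreal (N powr (q - 1) / (q - 1)) + ennreal (N powr (q - 1) / (q - 1)))"
    using assms
    by (subst nn_integral_add, simp, simp, subst nn_integral_add, simp, simp,
        subst nn_integral_cmult_indicator) (simp_all add: t t')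
  also have "\<dots> = ennreal (N powr q * (2 / N) + (N powr (q - 1) / (q - 1) + N powr (q - 1) / (q - 1)))"
    using assms by (simp add: ennreal_plus[symmetric] ennreal_mult[symmetric] del: ennreal_plus)
  also have "N powr q * (2 / N) + (N powr (q - 1) / (q - 1) + N powr (q - 1) / (q - 1))
      = 2 * q / (q - 1) * N powr (q - 1)"
  proof -
    have "N powr q * (2 / N) = 2 * N powr (q - 1)"
      using assms by (simp add: powr_diff)
    then show ?thesis using assms by (simp add: divide_simps) (simp add: algebra_simps)
  qed
  finally show ?thesis .
qed

lemma nn_integral_period_le:
  "(\<integral>\<^sup>+x. f x \<partial>period_measure) \<le> (\<integral>\<^sup>+x. f x \<partial>lborel)"
proof -
  have "(\<integral>\<^sup>+x. f x \<partial>period_measure) \<le> (\<integral>\<^sup>+x. f x \<partial>lebesgue)"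
    by (subst nn_integral_restrict_space) (auto intro!: nn_integral_mono simp: indicator_def)
  then show ?thesis by (simp add: nn_integral_completion)
qed

text \<open>This replaces a variable exponent by its upper bound \<open>q\<close> at the price of 1,
  which integrates to only 2 pi over a period.\<close>

lemma powr_le_one_plus_powr:
  fixes z r q :: real
  assumes "z \<ge> 0" "1 \<le> r" "r \<le> q"
  shows "z powr r \<le> 1 + z powr q"
proof (cases "z \<le> 1")
  case True
  have "z powr r \<le> 1 powr r" using assms True by (intro powr_mono2) auto
  then show ?thesis by (simp add: add_increasing2)
next
  case False
  then have "z powr r \<le> z powr q" using assms by (intro powr_mono) auto
  then show ?thesis by simp
qed

text \<open>With R = N^(1-1/q) one has R^q = N^(q-1), exactly the growth in
  \<open>nn_integral_peak_bound\<close>, so the modular of g/R is at most 2 pi + A^q 2q/(q-1) for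
  every \<open>N\<close>. Since K \<ge> 1 and p(x) \<ge> 1 almost everywhere, K^p(x) \<ge> K, so a
  further division of the function by \<open>K\<close> brings the modular below 1.\<close>

lemma modular_peak_le_one:
  fixes A N q K :: real
  assumes p: "AE x in period_measure. 1 \<le> p x \<and> p x \<le> q"
    and g: "\<And>x. \<bar>x\<bar> \<le> pi \<Longrightarrow> \<bar>g x\<bar> \<le> A * peak_bound N x"
    and A: "A \<ge> 0" and N: "N > 0" and q: "q > 1"
    and K: "K \<ge> 1" "2 * pi + A powr q * (2 * q / (q - 1)) \<le> K"
  shows "modular p (\<lambda>x. g x / (K * N powr (1 - 1 / q))) \<le> 1"
proof -
  define R where "R = N powr (1 - 1 / q)"
  have "R > 0" using N by (simp add: R_def)
  have Rq: "R powr q = N powr (q - 1)"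
  proof -
    have "(1 - 1 / q) * q = q - 1" using q by (simp add: algebra_simps)
    then show ?thesis by (simp add: R_def powr_powr)
  qed
  have pw: "\<bar>g x / (K * R)\<bar> powr p x \<le> 1 / K + A powr q / (K * N powr (q - 1)) * peak_bound N x powr q"
    if "\<bar>x\<bar> \<le> pi" "1 \<le> p x" "p x \<le> q" for x
  proof -
    define z where "z = \<bar>g x\<bar> / R"
    have "z \<ge> 0" using \<open>R > 0\<close> by (simp add: z_def)
    have "\<bar>g x / (K * R)\<bar> powr p x = (z / K) powr p x"
      using K \<open>R > 0\<close> by (simp add: z_def abs_mult mult.commute)
    also have "\<dots> = z powr p x / K powr p x"
      using \<open>z \<ge> 0\<close> K by (simp add: powr_divide)
    also have "\<dots> \<le> z powr p x / K"
      using K that powr_mono[of 1 "p x" K] by (intro divide_left_mono) auto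
    also have "\<dots> \<le> (1 + z powr q) / K"
      using K that \<open>z \<ge> 0\<close> by (intro divide_right_mono powr_le_one_plus_powr) auto
    also have "z powr q \<le> (A * peak_bound N x / R) powr q"
      unfolding z_def using g[of x] that q \<open>R > 0\<close>
      by (intro powr_mono2 divide_right_mono) auto
    also have "(A * peak_bound N x / R) powr q = A powr q / N powr (q - 1) * peak_bound N x powr q"
      using A N \<open>R > 0\<close> peak_bound_nonneg[of N x] by (simp add: powr_divide powr_mult Rq)
    finally show ?thesis
      using K by (simp add: add_divide_distrib divide_right_mono mult.commute)
  qed
  have "modular p (\<lambda>x. g x / (K * R)) \<le>
      (\<integral>\<^sup>+x. ennreal (1 / K + A powr q / (K * N powr (q - 1)) * peak_bound N x powr q) \<partial>period_measure)"
    unfolding modular_def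
  proof (rule nn_integral_mono_AE)
    show "AE x in period_measure. ennreal (\<bar>g x / (K * R)\<bar> powr p x) \<le>
      ennreal (1 / K + A powr q / (K * N powr (q - 1)) * peak_bound N x powr q)"
      using p AE_space
    proof eventually_elim
      case (elim x)
      then show ?case by (intro ennreal_leI pw) (auto simp: abs_le_iff)
    qed
  qed
  also have "\<dots> = (\<integral>\<^sup>+x. ennreal (1 / K) \<partial>period_measure) +
      (\<integral>\<^sup>+x. ennreal (A powr q / (K * N powr (q - 1))) * ennreal (peak_bound N x powr q) \<partial>period_measure)"
  proof -
    have "(\<lambda>x. ennreal (peak_bound N x powr q)) \<in> borel_measurable period_measure"
      by (rule measurable_restrict_space1, rule measurable_completion) simp
    moreover have "ennreal (1 / K + A powr q / (K * N powr (q - 1)) * peak_bound N x powr q) =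
        ennreal (1 / K) + ennreal (A powr q / (K * N powr (q - 1))) * ennreal (peak_bound N x powr q)" for x
      using K by (subst ennreal_plus) (auto simp: ennreal_mult[symmetric])
    ultimately show ?thesis
      by (simp only:) (subst nn_integral_add, auto)
  qed
  also have "\<dots> \<le> ennreal (2 * pi / K) +
      ennreal (A powr q / (K * N powr (q - 1))) * ennreal (2 * q / (q - 1) * N powr (q - 1))"
  proof (rule add_mono)
    show "(\<integral>\<^sup>+x. ennreal (1 / K) \<partial>period_measure) \<le> ennreal (2 * pi / K)"
      using K by (simp add: emeasure_restrict_space ennreal_mult[symmetric])
    have "(\<lambda>x. ennreal (peak_bound N x powr q)) \<in> borel_measurable period_measure"
      by (rule measurable_restrict_space1, rule measurable_completion) simp
    then have "(\<integral>\<^sup>+x. ennreal (A powr q / (K * N powr (q - 1))) * ennreal (peak_bound N x powr q) \<partial>period_measure)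
      = ennreal (A powr q / (K * N powr (q - 1))) * (\<integral>\<^sup>+x. ennreal (peak_bound N x powr q) \<partial>period_measure)"
      by (rule nn_integral_cmult)
    also have "\<dots> \<le> ennreal (A powr q / (K * N powr (q - 1))) * ennreal (2 * q / (q - 1) * N powr (q - 1))"
      by (intro mult_left_mono order_trans[OF nn_integral_period_le nn_integral_peak_bound] N q) auto
    finally show "(\<integral>\<^sup>+x. ennreal (A powr q / (K * N powr (q - 1))) * ennreal (peak_bound N x powr q) \<partial>period_measure)
      \<le> ennreal (A powr q / (K * N powr (q - 1))) * ennreal (2 * q / (q - 1) * N powr (q - 1))" .
  qed
  also have "\<dots> = ennreal (2 * pi / K + A powr q / (K * N powr (q - 1)) * (2 * q / (q - 1) * N powr (q - 1)))"
    using K q by (simp add: ennreal_mult[symmetric] del: ennreal_plus flip: ennreal_plus)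
  also have "2 * pi / K + A powr q / (K * N powr (q - 1)) * (2 * q / (q - 1) * N powr (q - 1))
      = (2 * pi + A powr q * (2 * q / (q - 1))) / K"
    using N K q by (simp add: field_simps)
  also have "ennreal \<dots> \<le> 1"
    using K q by (simp add: ennreal_le_1)
  finally show ?thesis by (simp add: R_def)
qed

text \<open>For an admissible \<alpha> put y = H/\<alpha>. If y > 1, the integrand is at least y^r
  on an interval of length 1/N, so y^r/N \<le> 1 and \<alpha> \<ge> H N^(-1/r).\<close>

lemma norm_var_peak_ge:
  fixes N H r :: real
  assumes s: "AE x in period_measure. r \<le> s x" and r: "r \<ge> 1"
    and f: "\<And>x. \<bar>x\<bar> \<le> 1 / (2 * N) \<Longrightarrow> H \<le> f x"
    and H: "H > 0" and N: "N \<ge> 1"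
  shows "norm_var s f \<ge> ennreal (H * N powr (- 1 / r))"
  unfolding norm_var_def
proof (rule INF_greatest, clarify)
  fix \<alpha> :: real
  assume \<alpha>: "\<alpha> > 0" and m: "modular s (\<lambda>x. f x / \<alpha>) \<le> 1"
  define y where "y = H / \<alpha>"
  have "y > 0" using \<alpha> H by (simp add: y_def)
  let ?I = "{- (1 / (2 * N))..1 / (2 * N)}"
  have "1 / (2 * N) \<le> 1" using N by simp
  also have "1 \<le> pi" using pi_gt3 by simp
  finally have I: "?I \<subseteq> {-pi..pi}" by auto
  \<comment> \<open>Lowering the exponent from s(x) to \<open>r\<close> requires a base of at least
    1; for y \<le> 1 the claim follows from N \<ge> 1 instead.\<close>
  have "y \<le> N powr (1 / r)"
  proof (cases "y \<le> 1")
    case True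
    also have "1 \<le> N powr (1 / r)" using N r by (simp add: ge_one_powr_ge_zero)
    finally show ?thesis .
  next
    case False
    have "ennreal (y powr r / N) = (\<integral>\<^sup>+x. ennreal (y powr r) * indicator ?I x \<partial>period_measure)"
    proof -
      have "emeasure period_measure ?I = ennreal (1 / N)"
        using N I by (simp add: emeasure_restrict_space)
      then show ?thesis
        using N I by (subst nn_integral_cmult_indicator)
          (auto simp: sets_restrict_space_iff ennreal_mult[symmetric])
    qed
    also have "\<dots> \<le> modular s (\<lambda>x. f x / \<alpha>)"
      unfolding modular_def
    proof (rule nn_integral_mono_AE)
      show "AE x in period_measure. ennreal (y powr r) * indicator ?I x \<le> ennreal (\<bar>f x / \<alpha>\<bar> powr s x)"
        using s
      proof eventually_elim
        case (elim x)
        show ?case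
        proof (cases "x \<in> ?I")
          case True
          then have "y \<le> f x / \<alpha>"
            unfolding y_def using f[of x] \<alpha> by (intro divide_right_mono) auto
          then have "y \<le> \<bar>f x / \<alpha>\<bar>" by linarith
          then have "y powr r \<le> \<bar>f x / \<alpha>\<bar> powr r"
            using r \<open>y > 0\<close> by (intro powr_mono2) auto
          also have "\<dots> \<le> \<bar>f x / \<alpha>\<bar> powr s x"
            using False \<open>y \<le> \<bar>f x / \<alpha>\<bar>\<close> elim by (intro powr_mono) auto
          finally show ?thesis using True by (simp add: ennreal_leI)
        qed simp
      qed
    qed
    also note m
    finally have "y powr r \<le> N"
      using N by simp
    then have "(y powr r) powr (1 / r) \<le> N powr (1 / r)"
      using r by (intro powr_mono2) auto
    then show ?thesis using r \<open>y > 0\<close> by (simp add: powr_powr)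
  qed
  then have "H * N powr (- 1 / r) \<le> \<alpha>"
    using \<alpha> N by (simp add: y_def field_simps powr_minus)
  then show "ennreal (H * N powr (- 1 / r)) \<le> ennreal \<alpha>" by (rule ennreal_leI)
qed

section \<open>Essential bounds of the exponents as real numbers\<close>

lemma not_AE_False_period: "\<not> (AE x in period_measure. False)"
  using ae_filter_eq_bot_iff[of period_measure]
  by (simp add: trivial_limit_def emeasure_restrict_space)

lemma exponent_class_upper:
  assumes "p \<in> exponent_class \<gamma>"
  defines "q \<equiv> real_of_ereal (ess_upper p)"
  shows "q > 1" and "AE x in period_measure. 1 \<le> p x \<and> p x \<le> q"
proof -
  have p: "\<And>x. p x > 1" "ess_upper p < \<infinity>"
    using assms by (auto simp: exponent_class_def variable_exponent_def)
  have AE: "AE x in period_measure. ereal \<bar>p x\<bar> \<le> ess_upper p"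
    unfolding ess_upper_def by (rule esssup_AE)
  \<comment> \<open>A value of at most 1 would force p \<le> 1 almost everywhere, against p > 1 on a
    set of positive measure. Strictness matters because q - 1 becomes a denominator.\<close>
  have gt: "ess_upper p > 1"
  proof (rule ccontr)
    assume "\<not> ?thesis"
    then have "ess_upper p \<le> 1" by simp
    from AE have "AE x in period_measure. False"
    proof eventually_elim
      case (elim x)
      then have "ereal \<bar>p x\<bar> \<le> 1" using \<open>ess_upper p \<le> 1\<close> by (rule order_trans)
      then show ?case using p(1)[of x] by simp
    qed
    then show False using not_AE_False_period by contradiction
  qed
  then obtain r where r: "ess_upper p = ereal r"
    using p(2) by (cases "ess_upper p") auto
  then show "q > 1" using gt by (simp add: q_def)
  from AE show "AE x in period_measure. 1 \<le> p x \<and> p x \<le> q"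
  proof eventually_elim
    case (elim x)
    then show ?case using p(1)[of x] by (simp add: q_def r)
  qed
qed

lemma exponent_class_lower:
  assumes "s \<in> exponent_class \<gamma>"
  defines "r \<equiv> real_of_ereal (ess_lower s)"
  shows "r \<ge> 1" and "AE x in period_measure. r \<le> s x"
proof -
  have s: "\<And>x. s x > 1" and m: "s \<in> borel_measurable period_measure"
    using assms by (auto simp: exponent_class_def variable_exponent_def)
  define E where "E = esssup period_measure (\<lambda>x. - ereal \<bar>s x\<bar>)"
  have AE: "AE x in period_measure. - ereal \<bar>s x\<bar> \<le> E"
    unfolding E_def by (rule esssup_AE)
  have "E \<le> -1"
    unfolding E_def
  proof (rule esssup_I)
    show "AE x in period_measure. - ereal \<bar>s x\<bar> \<le> - 1"
    proof (rule AE_I2)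
      fix x show "- ereal \<bar>s x\<bar> \<le> - 1" using s[of x] by (simp add: one_ereal_def)
    qed
  qed (use m in measurable)
  \<comment> \<open>Real values cannot lie below -\<infinity> on a set of positive measure. Thus
    \<open>E\<close> is finite and \<open>real_of_ereal\<close> returns the true essential infimum,
    not a default value.\<close>
  moreover have "E \<noteq> -\<infinity>"
  proof
    assume "E = -\<infinity>"
    with AE have "AE x in period_measure. False" by simp
    then show False using not_AE_False_period by contradiction
  qed
  ultimately obtain e where e: "E = ereal e" "e \<le> -1"
    by (cases E) (auto simp: one_ereal_def)
  then have r: "r = - e" by (simp add: r_def ess_lower_def E_def)
  then show "r \<ge> 1" using e by simp
  from AE show "AE x in period_measure. r \<le> s x"
  proof eventually_elim
    case (elim x)
    then show ?case using s[of x] by (simp add: r e)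
  qed
qed

section \<open>The test polynomial: derivative, Zygmund sum and pointwise bounds\<close>

lemma cos_sum_has_psi_derivative:
  fixes c :: "nat \<Rightarrow> real"
  assumes "finite A" "0 \<notin> A"
  shows "has_psi_derivative \<psi> \<beta> (\<lambda>x. \<Sum>k\<in>A. c k * cos (real k * x))
    (\<lambda>x. \<Sum>k\<in>A. c k / \<psi> k * cos (real k * x + \<beta> * pi / 2))"
proof -
  note a = fourier_coeffs_cos_sum[OF assms(1,2), of c 0]
  note b = fourier_coeffs_cos_sum[OF assms(1,2), of "\<lambda>k. c k / \<psi> k" "\<beta> * pi / 2"]
  show ?thesis
    unfolding has_psi_derivative_def fourier_term_def b
  proof (intro conjI allI impI)
    show "(\<lambda>x. \<Sum>k\<in>A. c k * cos (real k * x)) \<in> L_space"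
      using cos_sum_in_L_space[of c 0 A] by simp
    show "(\<lambda>x. \<Sum>k\<in>A. c k / \<psi> k * cos (real k * x + \<beta> * pi / 2)) \<in> L_space"
      by (rule cos_sum_in_L_space)
  qed (use assms(2) a in \<open>auto simp: cos_add diff_divide_distrib algebra_simps\<close>)
qed

text \<open>The sum sees only the mean and frequencies below \<open>n\<close>, and \<open>A\<close>
  contains none of these. The approximation error of such a function is therefore the function
  itself.\<close>

lemma zygmund_sum_cos_sum:
  fixes c :: "nat \<Rightarrow> real"
  assumes "finite A" "0 \<notin> A" "\<And>k. k \<in> A \<Longrightarrow> n \<le> k"
  shows "zygmund_sum \<psi> n (\<lambda>x. \<Sum>k\<in>A. c k * cos (real k * x)) x = 0"
proof -
  have "fourier_a (\<lambda>x. \<Sum>k\<in>A. c k * cos (real k * x)) j = 0"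
    "fourier_b (\<lambda>x. \<Sum>k\<in>A. c k * cos (real k * x)) j = 0" if "j \<notin> A" for j
    using that fourier_coeffs_cos_sum[OF assms(1,2), of c 0 j] by simp_all
  moreover have "j \<notin> A" if "j < n" for j
    using that assms(3)[of j] by auto
  ultimately show ?thesis
    using assms(2) by (auto simp: zygmund_sum_def fourier_term_def intro!: sum.neutral)
qed

lemma cos_ge_half:
  fixes y :: real
  assumes "\<bar>y\<bar> \<le> 1"
  shows "cos y \<ge> 1 / 2"
proof -
  have "1 \<le> pi / 3" using pi_gt3 by simp
  then have "cos (pi / 3) \<le> cos \<bar>y\<bar>"
    using assms by (intro cos_monotone_0_pi_le) auto
  then show ?thesis by (simp add: cos_60)
qed

text \<open>Away from 0, Abel summation gives (C + 2C) * 4/\<bar>x\<bar>: the last coefficient, the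
  variation and the bound for cosine sums. This is the source of 12. Near 0, the n + 1 terms of size
  at most \<open>C\<close> are simply added.\<close>

lemma abs_tau_cos_sum_le:
  fixes C :: real
  assumes bound: "\<And>k. n \<le> k \<Longrightarrow> k \<le> 2 * n \<Longrightarrow> \<bar>nu \<psi> n / \<psi> k\<bar> \<le> C"
    and var: "\<And>m. m \<ge> 1 \<Longrightarrow>
      (\<Sum>k\<in>{2 ^ m..2 ^ (m + 1)}. \<bar>tau \<psi> n (k + 1) - tau \<psi> n k\<bar>) \<le> C"
    and n: "n \<ge> 1" and x: "\<bar>x\<bar> \<le> pi"
  shows "\<bar>\<Sum>k=n..2*n. nu \<psi> n / \<psi> k * cos (real k * x + \<theta>)\<bar> \<le> 12 * C * peak_bound (real n) x"
proof -
  have "0 \<le> \<bar>nu \<psi> n / \<psi> n\<bar>" by simp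
  also have "\<dots> \<le> C" using bound[of n] by simp
  finally have "C \<ge> 0" .
  show ?thesis
  proof (cases "\<bar>x\<bar> \<le> 1 / real n")
    case True
    have "\<bar>\<Sum>k=n..2*n. nu \<psi> n / \<psi> k * cos (real k * x + \<theta>)\<bar>
        \<le> (\<Sum>k=n..2*n. \<bar>nu \<psi> n / \<psi> k * cos (real k * x + \<theta>)\<bar>)"
      by (rule sum_abs)
    also have "\<dots> \<le> (\<Sum>k=n..2*n. C * 1)"
      unfolding abs_mult using bound \<open>C \<ge> 0\<close> by (intro sum_mono mult_mono) auto
    also have "\<dots> = (real n + 1) * C" by simp
    also have "\<dots> \<le> (12 * real n) * C" using n \<open>C \<ge> 0\<close> by (intro mult_right_mono) auto
    finally show ?thesis using True by (simp add: peak_bound_def mult_ac)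
  next
    case False
    then have "x \<noteq> 0" by auto
    have "\<bar>\<Sum>k=n..2*n. tau \<psi> n k * cos (real k * x + \<theta>)\<bar> \<le>
        (\<bar>tau \<psi> n (2 * n)\<bar> + (\<Sum>k=n..<2*n. \<bar>tau \<psi> n (Suc k) - tau \<psi> n k\<bar>)) * (4 / \<bar>x\<bar>)"
      using x \<open>x \<noteq> 0\<close> by (intro abs_sum_le_variation abs_sum_cos_le) auto
    also have "\<dots> \<le> (C + 2 * C) * (4 / \<bar>x\<bar>)"
      using bound[of "2 * n"] tau_variation_le[OF bound var n]
      by (intro mult_right_mono add_mono) (auto simp: tau_def)
    also have "(\<Sum>k=n..2*n. tau \<psi> n k * cos (real k * x + \<theta>)) =
        (\<Sum>k=n..2*n. nu \<psi> n / \<psi> k * cos (real k * x + \<theta>))"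
      by (intro sum.cong) (auto simp: tau_def)
    finally show ?thesis using False by (simp add: peak_bound_def)
  qed
qed

theorem theorem3:
  fixes \<gamma> \<beta> :: real and p s :: "real \<Rightarrow> real" and \<psi> :: "nat \<Rightarrow> real"
  assumes "\<gamma> \<ge> 1"
    and "p \<in> exponent_class \<gamma>" and "s \<in> exponent_class \<gamma>"
    and "\<forall>x\<in>{0..2 * pi}. p x < s x"
    and "\<forall>k\<ge>1. \<psi> k \<noteq> 0"
    and "(\<psi>, \<beta>) \<in> pair_class"
  shows "\<exists>C>0. \<forall>n\<ge>1.
    zygmund_error \<psi> \<beta> p s n \<ge>
      ennreal (C * nu \<psi> n *
        real n powr (1 / real_of_ereal (ess_upper p) - 1 / real_of_ereal (ess_lower s)))"
proof -
  define q where "q = real_of_ereal (ess_upper p)"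
  define r where "r = real_of_ereal (ess_lower s)"
  have q: "q > 1" "AE x in period_measure. 1 \<le> p x \<and> p x \<le> q"
    unfolding q_def by (rule exponent_class_upper[OF assms(2)])+
  have r: "r \<ge> 1" "AE x in period_measure. r \<le> s x"
    unfolding r_def by (rule exponent_class_lower[OF assms(3)])+
  obtain C where C: "C > 0"
    and bdd: "\<And>n. n \<ge> 1 \<Longrightarrow> bdd_above ((\<lambda>k. \<bar>\<psi> k\<bar>) ` {n..})"
    and bound: "\<And>n k. n \<ge> 1 \<Longrightarrow> n \<le> k \<Longrightarrow> k \<le> 2 * n \<Longrightarrow> \<bar>nu \<psi> n / \<psi> k\<bar> \<le> C"
    and var: "\<And>n m. n \<ge> 1 \<Longrightarrow> m \<ge> 1 \<Longrightarrow>
      (\<Sum>k\<in>{2 ^ m..2 ^ (m + 1)}. \<bar>tau \<psi> n (k + 1) - tau \<psi> n k\<bar>) \<le> C"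
    using assms(6) unfolding pair_class_def by auto
  \<comment> \<open>The smallest constant allowed by \<open>modular_peak_le_one\<close> with A = 12
    C; it does not depend on \<open>n\<close>.\<close>
  define K where "K = max 1 (2 * pi + (12 * C) powr q * (2 * q / (q - 1)))"
  have K: "K \<ge> 1" "2 * pi + (12 * C) powr q * (2 * q / (q - 1)) \<le> K"
    by (simp_all add: K_def)
  \<comment> \<open>The factor 1/2 is the lower bound of the cosines near the origin, and 1/K comes
    from normalising the derivative.\<close>
  have "ennreal (1 / (2 * K) * nu \<psi> n * real n powr (1 / q - 1 / r)) \<le> zygmund_error \<psi> \<beta> p s n"
    if n: "n \<ge> 1" for n
  proof -
    \<comment> \<open>Division by \<alpha> brings the modular of the derivative down to at most 1,
      so that \<open>f\<close> belongs to the class.\<close>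
    define \<alpha> where "\<alpha> = K * real n powr (1 - 1 / q)"
    have "\<alpha> > 0" using K n by (simp add: \<alpha>_def)
    define f where "f = (\<lambda>x. \<Sum>k=n..2*n. nu \<psi> n / \<alpha> * cos (real k * x))"
    define g where "g = (\<lambda>x. \<Sum>k=n..2*n. nu \<psi> n / \<alpha> / \<psi> k * cos (real k * x + \<beta> * pi / 2))"
    \<comment> \<open>Boundedness makes the real supremum genuine; since \<open>\<psi> n\<close> is
      nonzero, \<open>nu \<psi> n\<close> is positive.\<close>
    have "\<bar>\<psi> n\<bar> \<le> nu \<psi> n"
      unfolding nu_def using bdd[OF n] by (intro cSUP_upper) auto
    then have nu: "nu \<psi> n > 0" using assms(5) n by (meson less_le_trans zero_less_abs_iff)
    have deriv: "has_psi_derivative \<psi> \<beta> f g"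
      unfolding f_def g_def using n by (intro cos_sum_has_psi_derivative) auto
    have g: "g = (\<lambda>x. (\<Sum>k=n..2*n. nu \<psi> n / \<psi> k * cos (real k * x + \<beta> * pi / 2)) / \<alpha>)"
      by (simp add: g_def sum_divide_distrib mult.commute)
    have mod: "modular p g \<le> 1"
      unfolding g \<alpha>_def
      by (rule modular_peak_le_one[OF q(2) abs_tau_cos_sum_le[OF bound[OF n] var[OF n] n]])
        (use C K n q(1) in auto)
    moreover have "g \<in> L_space" using deriv by (simp add: has_psi_derivative_def)
    ultimately have "g \<in> Lp_var p"
      by (auto simp: Lp_var_def L_space_def intro: le_less_trans)
    \<comment> \<open>The value 1 is itself admissible in the infimum defining the norm.\<close>
    moreover have "norm_var p g \<le> 1"
      unfolding norm_var_def using mod by (intro INF_lower2[of 1]) auto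
    ultimately have "f \<in> psi_class \<psi> \<beta> p"
      using deriv by (auto simp: psi_class_def)
    then have "norm_var s (\<lambda>x. f x - zygmund_sum \<psi> n f x) \<le> zygmund_error \<psi> \<beta> p s n"
      unfolding zygmund_error_def by (rule SUP_upper)
    moreover have "zygmund_sum \<psi> n f x = 0" for x
      unfolding f_def using n by (intro zygmund_sum_cos_sum) auto
    moreover have "ennreal (nu \<psi> n * real n / (2 * \<alpha>) * real n powr (- 1 / r)) \<le> norm_var s f"
    proof (rule norm_var_peak_ge[OF r(2,1)])
      fix x :: real assume x: "\<bar>x\<bar> \<le> 1 / (2 * real n)"
      \<comment> \<open>There are n + 1 terms. Since k \<le> 2n and \<bar>x\<bar> \<le> 1/(2n),
        every argument kx lies in [-1, 1], where the cosine is at least 1/2.\<close>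
      have "nu \<psi> n * real n / (2 * \<alpha>) \<le> (\<Sum>k=n..2*n. nu \<psi> n / \<alpha> * (1 / 2))"
        using nu \<open>\<alpha> > 0\<close> by (simp add: field_simps)
      also have "\<dots> \<le> f x"
        unfolding f_def
      proof (intro sum_mono mult_left_mono cos_ge_half)
        fix k assume "k \<in> {n..2*n}"
        then have "\<bar>real k * x\<bar> \<le> (2 * real n) * (1 / (2 * real n))"
          unfolding abs_mult using x by (intro mult_mono) auto
        then show "\<bar>real k * x\<bar> \<le> 1" using n by simp
      qed (use nu \<open>\<alpha> > 0\<close> in auto)
      finally show "nu \<psi> n * real n / (2 * \<alpha>) \<le> f x" .
    qed (use nu \<open>\<alpha> > 0\<close> n in auto)
    moreover have "nu \<psi> n * real n / (2 * \<alpha>) * real n powr (- 1 / r) =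
        1 / (2 * K) * nu \<psi> n * real n powr (1 / q - 1 / r)"
    proof -
      have "real n powr (1 / q - 1 / r) = real n powr (1 - (1 - 1 / q) + - 1 / r)" by simp
      also have "\<dots> = real n / real n powr (1 - 1 / q) * real n powr (- 1 / r)"
        using n by (simp only: powr_add powr_diff) simp
      finally show ?thesis by (simp add: \<alpha>_def)
    qed
    ultimately show ?thesis by simp
  qed
  moreover have "1 / (2 * K) > 0" using K by simp
  ultimately show ?thesis unfolding q_def r_def by blast
qed

end
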